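(* Let $M$ be an $n\times n$ $Q_0$-matrix and let $$S(q)=\{x\in\mathbb{R}^n\mid x\ge0,\ Mx+q\ge0,\ x^\top(Mx+q)=0\},\qquad q\in\mathbb{R}^n.$$ Let $(\bar q,\bar x)\in\operatorname{gph} S$ and suppose that for every $u^*\in\mathbb{R}^n$ $$(u^*,-M^*u^* )\in W\big(I_1(\bar q,\bar x),I_2(\bar q,\bar x),I_3(\bar q,\bar x)\big)\ \Longrightarrow\ (u^*,-M^*u^* )\in W'\big(I_1(\bar q,\bar x),I_2(\bar q,\bar x),I_3(\bar q,\bar x)\big).$$ Then the graphical modulus of $S$ relative to $\operatorname{dom} S$ at $\bar q$ for $\bar x$ is $$\operatorname{lip}_{\operatorname{dom} S}S(\bar q\mid\bar x)=\sup_{(I_1,I_2,I_3)\in\mathcal{I}(\bar q,\bar x)}\ \sup_{u^*\in U(I_1,I_2,I_3)}\frac{d\big(u^*,N(I_1,I_2,I_3)\big)}{\left\|\begin{pmatrix}M^*_{(I_2,\cdot)}u^*\\ \big(-M^*_{(I_3,\cdot)}u^*\big)_+\end{pmatrix}\right\|},$$ where $$U(I_1,I_2,I_3)=\{u^*\in\mathbb{R}^n\mid u^*_i=0\ (i\in I_1),\ u^*_i\in\mathbb{R}\ (i\in I_2),\ u^*_i\in\mathbb{R}_-\ (i\in I_3)\}.$$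
   Context: $M$ is a $Q_0$-matrix if, for each $q\in\mathbb{R}^n$, the problem $x\ge0$, $Mx+q\ge0$, $x^\top(Mx+q)=0$ is solvable whenever it is feasible (i.e. whenever some $x\ge0$ satisfies $Mx+q\ge0$). $M^*$ is the transpose of $M$, and $M^*_{(J,\cdot)}$ is the submatrix of $M^*$ consisting of the rows indexed by $J$. $(y)_+$ is the componentwise positive part $(\max(0,y_i))_i$. $d(u,A)=\inf_{a\in A}\|u-a\|$. Quotients $0/0$ are read as $0$. $\operatorname{gph} S=\{(q,x)\mid x\in S(q)\}$, $\operatorname{dom} S=\{q\mid S(q)\ne\emptyset\}$. Let $I=\{1,\dots,n\}$, $\mathbb{R}_-=(-\infty,0]$. For $(q,x)\in\operatorname{gph} S$: $I_1(q,x)=\{i\mid x_i=0,(Mx+q)_i>0\}$, $I_2(q,x)=\{i\mid x_i>0,(Mx+q)_i=0\}$, $I_3(q,x)=\{i\mid x_i=0,(Mx+q)_i=0\}$. $\mathcal{I}$ is the set of all triples $(I_1,I_2,I_3)$ of pairwise disjoint (possibly empty) sets with union $I$, and $\mathcal{I}(\bar q,\bar x)=\{(I_1,I_2,I_3)\in\mathcal{I}\mid I_1\supseteq I_1(\bar q,\bar x),\ I_2\supseteq I_2(\bar q,\bar x),\ I_3\subseteq I_3(\bar q,\bar x)\}$. For $(I_1,I_2,I_3)\in\mathcal{I}$ and $\Omega:=(\{0\}\times\mathbb{R})\cup(\mathbb{R}\times\{0\})\cup\mathbb{R}^2_-$: $W(I_1,I_2,I_3)$ is the set of $(u^*,v^*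 )\in\mathbb{R}^n\times\mathbb{R}^n$ with $(u^*_i,v^*_i)\in\{0\}\times\mathbb{R}$ for $i\in I_1$, $\in\mathbb{R}\times\{0\}$ for $i\in I_2$, $\in\Omega$ for $i\in I_3$; $W'(I_1,I_2,I_3)$ is the set of $(u^*,v^* )$ with $(u^*_i,v^*_i)\in\{0\}\times\mathbb{R}_-$ for $i\in I_1$, $\in\mathbb{R}_-\times\{0\}$ for $i\in I_2$, $\in\mathbb{R}^2_-$ for $i\in I_3$; $N(I_1,I_2,I_3)$ is the set of $w\in\mathbb{R}^n$ with $\langle w,v\rangle=0$ for every column $v$ of $(E_{(\cdot,I_1)},-M_{(\cdot,I_2)})$ and $\langle w,u\rangle\le0$ for every column $u$ of $(E_{(\cdot,I\setminus I_1)},-M_{(\cdot,I\setminus I_2)})$, where $E$ is the identity matrix and $A_{(\cdot,J)}$ is the submatrix of columns indexed by $J$. Graphical modulus: $\operatorname{lip}_XS(\bar q\mid\bar x)$ is the infimum of all $\kappa\ge0$ for which there are neighborhoods $V$ of $\bar q$ and $U'$ of $\bar x$ such that $S(q')\cap U'\subset S(q)+\kappa\|q'-q\|\mathbb{B}$ for all $q,q'\in X\cap V$, with $\mathbb{B}$ the closed unit ball. *)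

theory Defs
  imports "HOL-Analysis.Analysis"
begin

definition LCP :: "real^'n^'n \<Rightarrow> real^'n \<Rightarrow> (real^'n) set" where
  "LCP M q = {x. 0 \<le> x \<and> 0 \<le> M *v x + q \<and> x \<bullet> (M *v x + q) = 0}"

definition Q0_matrix :: "real^'n^'n \<Rightarrow> bool" where
  "Q0_matrix M \<longleftrightarrow> (\<forall>q. (\<exists>x\<ge>0. 0 \<le> M *v x + q) \<longrightarrow> LCP M q \<noteq> {})"

definition gph :: "('a \<Rightarrow> 'b set) \<Rightarrow> ('a \<times> 'b) set" where
  "gph S = {(q, x). x \<in> S q}"

definition sdom :: "('a \<Rightarrow> 'b set) \<Rightarrow> 'a set" where
  "sdom S = {q. S q \<noteq> {}}"

text \<open>
  The modulus is extended-real valued: it is \<open>\<infinity>\<close> if no constant \<open>\<kappa>\<close> is admissible.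
  A neighbourhood of a point is any set having the point in its interior;
  the sum on the right-hand side of the inclusion is the Minkowski sum.
\<close>

definition lip_rel ::
  "'a::real_normed_vector set \<Rightarrow> ('a \<Rightarrow> 'b::real_normed_vector set) \<Rightarrow> 'a \<Rightarrow> 'b \<Rightarrow> ereal" where
  "lip_rel X S qb xb = Inf {ereal \<kappa> | \<kappa>. 0 \<le> \<kappa> \<and>
     (\<exists>V U. qb \<in> interior V \<and> xb \<in> interior U \<and>
        (\<forall>q \<in> X \<inter> V. \<forall>q' \<in> X \<inter> V.
           S q' \<inter> U \<subseteq> S q + (*\<^sub>R) (\<kappa> * norm (q' - q)) ` cball 0 1))}"

definition I1_at :: "real^'n^'n \<Rightarrow> real^'n \<Rightarrow> real^'n \<Rightarrow> 'n set" where
  "I1_at M q x = {i. x $ i = 0 \<and> (M *v x + q) $ i > 0}"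

definition I2_at :: "real^'n^'n \<Rightarrow> real^'n \<Rightarrow> real^'n \<Rightarrow> 'n set" where
  "I2_at M q x = {i. x $ i > 0 \<and> (M *v x + q) $ i = 0}"

definition I3_at :: "real^'n^'n \<Rightarrow> real^'n \<Rightarrow> real^'n \<Rightarrow> 'n set" where
  "I3_at M q x = {i. x $ i = 0 \<and> (M *v x + q) $ i = 0}"

definition index_triples :: "('n set \<times> 'n set \<times> 'n set) set" where
  "index_triples = {(I1, I2, I3). I1 \<inter> I2 = {} \<and> I1 \<inter> I3 = {} \<and> I2 \<inter> I3 = {} \<and>
     I1 \<union> I2 \<union> I3 = UNIV}"

definition index_triples_at ::
  "real^'n^'n \<Rightarrow> real^'n \<Rightarrow> real^'n \<Rightarrow> ('n set \<times> 'n set \<times> 'n set) set" where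
  "index_triples_at M q x = {(I1, I2, I3). (I1, I2, I3) \<in> index_triples \<and>
     I1_at M q x \<subseteq> I1 \<and> I2_at M q x \<subseteq> I2 \<and> I3 \<subseteq> I3_at M q x}"

definition Omega :: "(real \<times> real) set" where
  "Omega = ({0} \<times> UNIV) \<union> (UNIV \<times> {0}) \<union> ({..0} \<times> {..0})"

definition W_set :: "'n set \<Rightarrow> 'n set \<Rightarrow> 'n set \<Rightarrow> ((real^'n) \<times> (real^'n)) set" where
  "W_set I1 I2 I3 = {(u, v).
     (\<forall>i\<in>I1. (u $ i, v $ i) \<in> {0} \<times> UNIV) \<and>
     (\<forall>i\<in>I2. (u $ i, v $ i) \<in> UNIV \<times> {0}) \<and>
     (\<forall>i\<in>I3. (u $ i, v $ i) \<in> Omega)}"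

definition W'_set :: "'n set \<Rightarrow> 'n set \<Rightarrow> 'n set \<Rightarrow> ((real^'n) \<times> (real^'n)) set" where
  "W'_set I1 I2 I3 = {(u, v).
     (\<forall>i\<in>I1. (u $ i, v $ i) \<in> {0} \<times> {..0}) \<and>
     (\<forall>i\<in>I2. (u $ i, v $ i) \<in> {..0} \<times> {0}) \<and>
     (\<forall>i\<in>I3. (u $ i, v $ i) \<in> {..0} \<times> {..0})}"

text \<open>\<open>I3\<close> does not occur on the right-hand side below; it is kept as an argument so
  that all the sets are indexed by triples.\<close>

definition N_set :: "real^'n^'n \<Rightarrow> 'n set \<Rightarrow> 'n set \<Rightarrow> 'n set \<Rightarrow> (real^'n) set" where
  "N_set M I1 I2 I3 = {w.
     (\<forall>i\<in>I1. w \<bullet> column i (mat 1) = 0) \<and> (\<forall>i\<in>I2. w \<bullet> column i (- M) = 0) \<and>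
     (\<forall>i\<in>UNIV - I1. w \<bullet> column i (mat 1) \<le> 0) \<and> (\<forall>i\<in>UNIV - I2. w \<bullet> column i (- M) \<le> 0)}"

definition U_set :: "'n set \<Rightarrow> 'n set \<Rightarrow> 'n set \<Rightarrow> (real^'n) set" where
  "U_set I1 I2 I3 = {u. (\<forall>i\<in>I1. u $ i = 0) \<and> (\<forall>i\<in>I3. u $ i \<le> 0)}"

definition pos_part :: "real^'n \<Rightarrow> real^'n" where
  "pos_part y = (\<chi> i. max 0 (y $ i))"

text \<open>
  The submatrix of the rows of \<open>A\<close> in \<open>J\<close> is represented by replacing the rows outside \<open>J\<close>
  by zero rows. Products of this matrix with vectors, and their positive parts, then have
  the same Euclidean norm as those of the submatrix.
\<close>

definition row_restrict :: "'n set \<Rightarrow> real^'n^'n \<Rightarrow> real^'n^'n" where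
  "row_restrict J A = (\<chi> i. if i \<in> J then A $ i else 0)"

text \<open>
  The stacked vector in the denominator is a pair; the norm on pairs is the Euclidean one.
  In \<^typ>\<open>ereal\<close>, \<open>0 / 0 = 0\<close> and \<open>c / 0 = \<infinity>\<close> for \<open>c > 0\<close>.
\<close>

definition quot :: "real^'n^'n \<Rightarrow> 'n set \<Rightarrow> 'n set \<Rightarrow> 'n set \<Rightarrow> real^'n \<Rightarrow> ereal" where
  "quot M I1 I2 I3 u =
     ereal (infdist u (N_set M I1 I2 I3)) /
     ereal (norm (row_restrict I2 (transpose M) *v u,
                  pos_part (- (row_restrict I3 (transpose M) *v u))))"

end

theory Submission
  imports Defs
begin

text \<open>
  At a point \<open>(q, x)\<close> of the graph with index triple \<open>(I1, I2, I3)\<close>, the set \<open>N\<close> is the normal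
  cone of the polyhedral cone of all \<open>q\<close> that are feasible, and the denominator of the quotient
  is the least norm of an \<open>x\<^sup>*\<close> for which \<open>(u, x\<^sup>*)\<close> is a regular normal to the graph.

  For the lower bound on the modulus, realise the triple by a point \<open>(q, x)\<close> near the given one,
  project \<open>u\<close> onto the tangent cone of the domain at \<open>q\<close>, and move \<open>q\<close> along the projection;
  the nearby solutions provided by the Lipschitz property are then tested against \<open>(u, x\<^sup>*)\<close>.

  For the upper bound, let \<open>x' \<in> S(q')\<close> and minimise
  \<open>\<kappa> \<parallel>q - q''\<parallel> + sqrt (\<parallel>x'' - x'\<parallel>\<^sup>2 + \<delta>\<^sup>2)\<close> over \<open>(q'', x'')\<close> in the graph.
  At a minimiser with \<open>q'' \<noteq> q\<close> this function is differentiable, and stationarity yields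
  \<open>u = \<kappa> (q - q'') / \<parallel>q - q''\<parallel>\<close> with distance at least \<open>\<kappa>\<close> from \<open>N\<close> but with a
  denominator less than \<open>1\<close>, because the gradient of the smoothed norm has norm less than \<open>1\<close>.
  Hence \<open>q'' = q\<close>, and \<open>x''\<close> is the required point of \<open>S(q)\<close>.
\<close>

section \<open>The quotient and its denominator\<close>

text \<open>The regular normal of least norm paired with \<open>u\<close> in \<open>U_set\<close>:
  normality fixes the entries on \<open>I2\<close>, bounds those on \<open>I3\<close> above by
  \<open>(transpose M *v u) $ i\<close>, and leaves those on \<open>I1\<close> free, hence
  \<open>0\<close>.\<close>

definition min_coderiv :: "real^'n^'n \<Rightarrow> 'n set \<Rightarrow> 'n set \<Rightarrow> real^'n \<Rightarrow> real^'n" where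
  "min_coderiv M I2 I3 u = (\<chi> i. if i \<in> I2 then (transpose M *v u) $ i
     else if i \<in> I3 then min 0 ((transpose M *v u) $ i) else 0)"

lemma row_restrict_mult_nth:
  "(row_restrict J A *v u) $ i = (if i \<in> J then (A *v u) $ i else 0)"
  by (simp add: row_restrict_def matrix_vector_mult_def)

text \<open>The two stacked blocks have disjoint supports and are therefore orthogonal, so the pair
  has the norm of their difference; \<open>- max 0 (- t) = min 0 t\<close> identifies that
  difference.\<close>

lemma quot_eq:
  assumes "I2 \<inter> I3 = {}"
  shows "quot M I1 I2 I3 u =
    ereal (infdist u (N_set M I1 I2 I3)) / ereal (norm (min_coderiv M I2 I3 u))"
proof -
  let ?a = "row_restrict I2 (transpose M) *v u"
  let ?b = "pos_part (- (row_restrict I3 (transpose M) *v u))"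
  have "?a $ i * ?b $ i = 0" for i
    using assms by (auto simp: row_restrict_mult_nth pos_part_def)
  then have "?a \<bullet> ?b = 0"
    unfolding inner_vec_def inner_real_def by (intro sum.neutral) blast
  then have "norm (?a - ?b) ^ 2 = norm ?a ^ 2 + norm ?b ^ 2"
    by (simp add: power2_norm_eq_inner inner_diff inner_commute)
  then have "norm (?a, ?b) = norm (?a - ?b)"
    unfolding norm_Pair by (metis norm_ge_zero real_sqrt_unique)
  moreover have "?a - ?b = min_coderiv M I2 I3 u"
    using assms
    by (auto simp: vec_eq_iff min_coderiv_def pos_part_def row_restrict_mult_nth)
  ultimately show ?thesis by (simp add: quot_def)
qed

text \<open>For \<open>b = 0\<close> both sides say \<open>a = 0\<close>, by the conventions for
  division by zero. Bounds on quotients thus become real inequalities with the denominator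
  cleared.\<close>

lemma ereal_divide_le_iff:
  fixes a b k :: real
  assumes "0 \<le> a" "0 \<le> b" "0 \<le> k"
  shows "ereal a / ereal b \<le> ereal k \<longleftrightarrow> a \<le> k * b"
proof (cases "b = 0")
  case True
  then show ?thesis using assms by (cases "a = 0") (auto simp: zero_ereal_def[symmetric] divide_ereal_def)
next
  case False
  then show ?thesis using assms by (simp add: field_simps)
qed

section \<open>Solutions, index sets and their local stability\<close>

lemma LCP_iff:
  "x \<in> LCP M q \<longleftrightarrow> (\<forall>i. 0 \<le> x $ i \<and> 0 \<le> (M *v x + q) $ i \<and> (x $ i = 0 \<or> (M *v x + q) $ i = 0))"
proof -
  have "x \<bullet> (M *v x + q) = 0 \<longleftrightarrow> (\<forall>i. x $ i * (M *v x + q) $ i = 0)"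
    if "\<forall>i. 0 \<le> x $ i" "\<forall>i. 0 \<le> (M *v x + q) $ i"
    unfolding inner_vec_def inner_real_def
    using that by (subst sum_nonneg_eq_0_iff) auto
  then show ?thesis
    unfolding LCP_def mem_Collect_eq less_eq_vec_def zero_index by (metis mult_eq_0_iff)
qed

lemma continuous_on_slack:
  fixes M :: "real^'n^'n"
  shows "continuous_on UNIV (\<lambda>z. (M *v snd z + fst z) $ i)"
proof -
  have "continuous_on UNIV (\<lambda>z::(real^'n) \<times> (real^'n). M *v snd z)"
    by (intro linear_continuous_on_compose[OF _ matrix_vector_mul_linear] continuous_on_snd continuous_on_id)
  then show ?thesis by (intro continuous_on_component continuous_on_add continuous_on_fst continuous_on_id)
qed

lemma continuous_on_snd_nth: "continuous_on UNIV (\<lambda>z. (snd z :: real^'n) $ i)"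
  by (intro continuous_on_component continuous_on_snd continuous_on_id)

lemma closed_gph_LCP:
  fixes M :: "real^'n^'n"
  shows "closed (gph (LCP M))"
proof -
  have eq: "gph (LCP M) = (\<Inter>i. {z. 0 \<le> snd z $ i} \<inter> {z. 0 \<le> (M *v snd z + fst z) $ i} \<inter>
      ({z. snd z $ i = 0} \<union> {z. (M *v snd z + fst z) $ i = 0}))"
    unfolding gph_def LCP_iff by auto
  show ?thesis unfolding eq
    by (intro closed_INT ballI closed_Int closed_Un closed_Collect_le closed_Collect_eq
        continuous_on_const continuous_on_slack continuous_on_snd_nth)
qed

text \<open>Strict positivity of a coordinate or of a slack is an open condition, and
  complementarity then forces its partner to vanish.\<close>

lemma index_sets_stable:
  fixes M :: "real^'n^'n"
  assumes "x0 \<in> LCP M q0"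
  obtains r where "r > 0"
    "\<And>q x. x \<in> LCP M q \<Longrightarrow> dist q q0 < r \<Longrightarrow> dist x x0 < r \<Longrightarrow>
       I1_at M q0 x0 \<subseteq> I1_at M q x \<and> I2_at M q0 x0 \<subseteq> I2_at M q x"
proof -
  let ?Z = "(\<Inter>i\<in>{i. x0 $ i > 0}. {z. 0 < snd z $ i}) \<inter>
    (\<Inter>i\<in>{i. (M *v x0 + q0) $ i > 0}. {z. 0 < (M *v snd z + fst z) $ i})"
  have "open ?Z"
    by (intro open_Int open_INT ballI open_Collect_less continuous_on_const
        continuous_on_slack continuous_on_snd_nth finite)
  moreover have "(q0, x0) \<in> ?Z" by simp
  ultimately obtain e where e: "e > 0" "ball (q0, x0) e \<subseteq> ?Z" by (rule openE)
  show thesis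
  proof (rule that[of "e / 2"])
    show "e / 2 > 0" using e by simp
    fix q x assume x: "x \<in> LCP M q" "dist q q0 < e / 2" "dist x x0 < e / 2"
    have "dist (q, x) (q0, x0) \<le> dist q q0 + dist x x0"
      unfolding dist_Pair_Pair by (rule sqrt_sum_squares_le_sum) simp_all
    then have "(q, x) \<in> ball (q0, x0) e" using x(2,3) by (simp add: dist_commute)
    then have Z: "(q, x) \<in> ?Z" using e(2) by blast
    have pos: "0 < x0 $ i \<Longrightarrow> 0 < x $ i" "0 < (M *v x0 + q0) $ i \<Longrightarrow> 0 < (M *v x + q) $ i" for i
      using Z by simp_all
    have comp: "x $ i = 0 \<or> (M *v x + q) $ i = 0" for i using x(1) by (simp only: LCP_iff)
    show "I1_at M q0 x0 \<subseteq> I1_at M q x \<and> I2_at M q0 x0 \<subseteq> I2_at M q x"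
    proof (intro conjI subsetI)
      fix i assume "i \<in> I1_at M q0 x0"
      then have "0 < (M *v x + q) $ i" using pos(2) by (simp only: I1_at_def mem_Collect_eq)
      then show "i \<in> I1_at M q x" using comp[of i] by (simp add: I1_at_def)
    next
      fix i assume "i \<in> I2_at M q0 x0"
      then have "0 < x $ i" using pos(1) by (simp only: I2_at_def mem_Collect_eq)
      then show "i \<in> I2_at M q x" using comp[of i] by (simp add: I2_at_def)
    qed
  qed
qed

lemma slack_eq_0:
  assumes "x \<in> LCP M q" "i \<notin> I1_at M q x"
  shows "(M *v x + q) $ i = 0"
  using assms unfolding LCP_iff I1_at_def mem_Collect_eq by (metis order.order_iff_strict)

lemma coordinate_eq_0:
  assumes "x \<in> LCP M q" "i \<notin> I2_at M q x"
  shows "x $ i = 0"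
  using assms unfolding LCP_iff I2_at_def mem_Collect_eq by (metis order.order_iff_strict)

text \<open>Combined with the stability of the index sets, this places the triples of all graph
  points near \<open>(q0, x0)\<close> in the family over which the supremum is taken.\<close>

lemma index_triples_at_self:
  assumes "x \<in> LCP M q" "x0 \<in> LCP M q0"
    "I1_at M q0 x0 \<subseteq> I1_at M q x" "I2_at M q0 x0 \<subseteq> I2_at M q x"
  shows "(I1_at M q x, I2_at M q x, I3_at M q x) \<in> index_triples_at M q0 x0"
proof -
  have cover: "I1_at M q' x' \<union> I2_at M q' x' \<union> I3_at M q' x' = UNIV" if "x' \<in> LCP M q'" for q' x'
    using that unfolding LCP_iff I1_at_def I2_at_def I3_at_def
    by (auto simp: order.order_iff_strict)
  have "I1_at M q x \<inter> I2_at M q x = {}" "I1_at M q x \<inter> I3_at M q x = {}" "I2_at M q x \<inter> I3_at M q x = {}"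
    unfolding I1_at_def I2_at_def I3_at_def by auto
  then show ?thesis
    using cover[OF assms(1)] cover[OF assms(2)] assms(3,4)
    unfolding index_triples_at_def index_triples_def by blast
qed

lemma inner_column: "w \<bullet> column i A = (transpose A *v w) $ i"
  by (simp add: inner_vec_def column_def matrix_vector_mult_def transpose_def mult.commute)

lemma N_set_iff:
  assumes "I1 \<union> I2 \<union> I3 = UNIV"
  shows "w \<in> N_set M I1 I2 I3 \<longleftrightarrow> (\<forall>i. w $ i \<le> 0 \<and> 0 \<le> (transpose M *v w) $ i \<and>
    (i \<in> I1 \<longrightarrow> w $ i = 0) \<and> (i \<in> I2 \<longrightarrow> (transpose M *v w) $ i = 0))"
proof -
  have "transpose (- M) *v w = - (transpose M *v w)"
    by (simp add: vec_eq_iff matrix_vector_mult_def transpose_def sum_negf)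
  then show ?thesis
    unfolding N_set_def inner_column mem_Collect_eq
    by (simp add: transpose_mat) (use order.eq_iff in blast)
qed

text \<open>With \<open>y\<close> a change of slack and \<open>x\<close> a change of solution,
  \<open>y - M *v x\<close> is a change of parameter. Its pairing with \<open>u\<close> splits so
  that signs can be checked index by index.\<close>

lemma inner_split:
  fixes M :: "real^'n^'n"
  shows "u \<bullet> (y - M *v x) = (\<Sum>i\<in>UNIV. u $ i * y $ i - (transpose M *v u) $ i * x $ i)"
proof -
  have "u \<bullet> (M *v x) = (transpose M *v u) \<bullet> x"
    by (simp add: dot_lmul_matrix)
  then show ?thesis
    by (simp add: inner_diff_right sum_subtractf) (simp add: inner_vec_def)
qed

section \<open>Closedness of finitely generated cones\<close>

text \<open>The point \<open>- a\<close> has positive distance \<open>d\<close> from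
  \<open>K\<close>. Rescaling bounds \<open>l\<close> by
  \<open>norm (c + l *\<^sub>R a) / d\<close>, so along a convergent sequence the multipliers stay
  in a compact interval, and the sum of a closed and a compact set is closed.\<close>

lemma closed_convex_cone_plus_ray:
  fixes a :: "'a::euclidean_space"
  assumes K: "closed K" "convex_cone K" and a: "- a \<notin> K"
  shows "closed {c + l *\<^sub>R a | c l. c \<in> K \<and> 0 \<le> l}" (is "closed ?C")
proof -
  obtain d where d: "d > 0" "\<And>c. c \<in> K \<Longrightarrow> d \<le> dist (- a) c"
    using separate_point_closed[OF K(1) a] by blast
  have bound: "l * d \<le> norm (c + l *\<^sub>R a)" if "c \<in> K" "0 \<le> l" for c l
  proof (cases "l = 0")
    case False
    then have "d \<le> dist (- a) (inverse l *\<^sub>R c)"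
      using that K(2) by (intro d convex_cone_scaleR) auto
    then have "l * d \<le> l * norm (a + inverse l *\<^sub>R c)"
      using that norm_minus_cancel[of "a + inverse l *\<^sub>R c"]
      by (intro mult_left_mono) (simp_all add: dist_norm)
    also have "\<dots> = norm (l *\<^sub>R (a + inverse l *\<^sub>R c))" using that by simp
    also have "l *\<^sub>R (a + inverse l *\<^sub>R c) = c + l *\<^sub>R a" using False by (simp add: scaleR_right_distrib)
    finally show ?thesis .
  qed simp
  have "z \<in> ?C" if f: "\<And>n. f n \<in> ?C" and lim: "f \<longlonglongrightarrow> z" for f z
  proof -
    obtain B where B: "\<And>n. norm (f n) \<le> B"
      using convergent_imp_bounded[OF lim] by (auto simp: bounded_iff)
    let ?D = "\<Union>x\<in>K. \<Union>y\<in>(\<lambda>l. l *\<^sub>R a) ` {0..B / d}. {x + y}"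
    have "closed ?D"
      by (intro closed_compact_sums K compact_continuous_image continuous_intros compact_Icc)
    moreover have "f n \<in> ?D" for n
    proof -
      obtain c l where cl: "f n = c + l *\<^sub>R a" "c \<in> K" "0 \<le> l" using f[of n] by blast
      then have "l * d \<le> B" using bound[of c l] B[of n] by simp
      then have "l \<in> {0..B / d}" using cl d by (simp add: pos_le_divide_eq)
      then show ?thesis using cl by blast
    qed
    ultimately have "z \<in> ?D" using lim closed_sequentially by blast
    then show ?thesis by fastforce
  qed
  then show ?thesis unfolding closed_sequential_limits by blast
qed

lemma convex_cone_hull_insert:
  "convex_cone hull (insert a S) = {c + l *\<^sub>R a | c l. c \<in> convex_cone hull S \<and> 0 \<le> l}" (is "_ = ?C")
proof (rule hull_unique[where S = convex_cone])
  show "insert a S \<subseteq> ?C"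
  proof
    fix x assume "x \<in> insert a S"
    then consider "x = a" | "x \<in> S" by blast
    then show "x \<in> ?C"
    proof cases
      case 1
      then show ?thesis using convex_cone_hull_contains_0[of S]
        by (auto intro!: exI[of _ 0] exI[of _ 1])
    next
      case 2
      then show ?thesis by (intro CollectI exI[of _ x] exI[of _ 0]) (simp add: hull_inc)
    qed
  qed
  show "convex_cone ?C"
  proof (rule iffD2[OF convex_cone_iff], intro conjI ballI allI impI)
    show "0 \<in> ?C" using convex_cone_hull_contains_0[of S] by (auto intro!: exI[of _ 0])
  next
    fix x y assume "x \<in> ?C" "y \<in> ?C"
    then obtain c l c' l' where "x = c + l *\<^sub>R a" "y = c' + l' *\<^sub>R a" "0 \<le> l" "0 \<le> l'"
      "c \<in> convex_cone hull S" "c' \<in> convex_cone hull S" by blast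
    then show "x + y \<in> ?C"
      by (intro CollectI exI[of _ "c + c'"] exI[of _ "l + l'"])
        (simp add: convex_cone_hull_add scaleR_left_distrib)
  next
    fix x and r :: real assume "x \<in> ?C" "0 \<le> r"
    then obtain c l where "x = c + l *\<^sub>R a" "0 \<le> l" "c \<in> convex_cone hull S" by blast
    then show "r *\<^sub>R x \<in> ?C" using \<open>0 \<le> r\<close>
      by (intro CollectI exI[of _ "r *\<^sub>R c"] exI[of _ "r * l"])
        (simp add: convex_cone_hull_mul scaleR_right_distrib)
  qed
  fix T assume T: "insert a S \<subseteq> T" "convex_cone T"
  then have "convex_cone hull S \<subseteq> T" by (intro hull_minimal) auto
  then show "?C \<subseteq> T" using T by (auto intro!: convex_cone_add convex_cone_scaleR)
qed

text \<open>
  Induction on the generators: adding \<open>a\<close> to a cone that contains \<open>- a\<close> adds the line spanned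
  by \<open>a\<close>, and the new cone is the preimage of the cone generated by the orthogonal projections
  of the old generators. This is why the statement is strengthened to all linear images.
\<close>

lemma closed_convex_cone_hull_finite_image:
  fixes f :: "'a::euclidean_space \<Rightarrow> 'a"
  assumes "finite S" "linear f"
  shows "closed (convex_cone hull (f ` S))"
  using assms
proof (induction S arbitrary: f rule: finite_induct)
  case (insert s S)
  define a where "a = f s"
  define K where "K = convex_cone hull (f ` S)"
  \<comment> \<open>Orthogonal projection along \<open>a\<close>. For \<open>a = 0\<close> the
    quotient is \<open>0\<close> and \<open>P\<close> is the identity, so this case needs no
    separate treatment.\<close>
  define P where "P x = x - ((x \<bullet> a) / (a \<bullet> a)) *\<^sub>R a" for x
  have K: "closed K" "convex_cone K"
    unfolding K_def using insert by (auto intro: convex_cone_convex_cone_hull)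
  have hull: "convex_cone hull (f ` insert s S) = {c + l *\<^sub>R a | c l. c \<in> K \<and> 0 \<le> l}"
    unfolding K_def a_def using convex_cone_hull_insert by simp
  show ?case
  proof (cases "- a \<in> K")
    case False
    then show ?thesis unfolding hull by (rule closed_convex_cone_plus_ray[OF K])
  next
    case True
    have P: "linear P"
      unfolding P_def
      by (intro linearI) (auto simp: inner_add_left algebra_simps add_divide_distrib)
    have Pa: "P a = 0" by (auto simp: P_def)
    have "closed (convex_cone hull ((P \<circ> f) ` S))"
      using insert.IH[of "P \<circ> f"] insert.prems P linear_compose by blast
    then have "closed (P ` K)"
      unfolding K_def by (simp only: image_comp[symmetric] convex_cone_hull_linear_image[OF P])
    then have "closed (P -` (P ` K))"
      using P linear_continuous_at[of P] linear_conv_bounded_linear[of P]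
      by (intro continuous_closed_vimage) auto
    moreover have "P -` (P ` K) = {c + l *\<^sub>R a | c l. c \<in> K \<and> 0 \<le> l}"
    proof (intro equalityI subsetI)
      fix x assume "x \<in> P -` (P ` K)"
      then obtain c where c: "c \<in> K" "P x = P c" by blast
      define m where "m = (x \<bullet> a) / (a \<bullet> a) - (c \<bullet> a) / (a \<bullet> a)"
      have x: "x = c + m *\<^sub>R a"
        using c(2) by (simp add: P_def m_def algebra_simps)
      show "x \<in> {c + l *\<^sub>R a | c l. c \<in> K \<and> 0 \<le> l}"
      proof (cases "0 \<le> m")
        case True
        then show ?thesis using x c by blast
      next
        case False
        \<comment> \<open>A negative multiple of \<open>a\<close> is absorbed into the cone part,
          since \<open>- a \<in> K\<close>.\<close>
        have "x = (c + (- m) *\<^sub>R (- a)) + 0 *\<^sub>R a" using x by simp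
        moreover have "c + (- m) *\<^sub>R (- a) \<in> K"
          using False \<open>- a \<in> K\<close> K(2) c by (intro convex_cone_add convex_cone_scaleR) auto
        ultimately show ?thesis by blast
      qed
    next
      fix x assume "x \<in> {c + l *\<^sub>R a | c l. c \<in> K \<and> 0 \<le> l}"
      then obtain c l where "x = c + l *\<^sub>R a" "c \<in> K" by blast
      then show "x \<in> P -` (P ` K)"
        using Pa by (simp add: linear_add[OF P] linear_cmul[OF P])
    qed
    ultimately show ?thesis unfolding hull by simp
  qed
qed simp

lemma closed_convex_cone_hull_finite:
  fixes S :: "'a::euclidean_space set"
  assumes "finite S"
  shows "closed (convex_cone hull S)"
  using closed_convex_cone_hull_finite_image[OF assms linear_id] by simp

section \<open>The tangent cone of the domain and projection onto it\<close>

text \<open>The tangent cone to the cone of feasible parameters at a graph point with this triple: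
  slacks may vary in both directions where they are positive, that is on \<open>I1\<close>, and
  coordinates of the solution on \<open>I2\<close>.\<close>

definition tangent_gen :: "real^'n^'n \<Rightarrow> 'n set \<Rightarrow> 'n set \<Rightarrow> (real^'n) set" where
  "tangent_gen M I1 I2 = {z - M *v x | z x. (\<forall>i. i \<notin> I1 \<longrightarrow> 0 \<le> z $ i) \<and> (\<forall>i. i \<notin> I2 \<longrightarrow> 0 \<le> x $ i)}"

lemma tangent_gen_add:
  assumes "a \<in> tangent_gen M I1 I2" "b \<in> tangent_gen M I1 I2"
  shows "a + b \<in> tangent_gen M I1 I2"
proof -
  obtain z x z' x' where "a = z - M *v x" "b = z' - M *v x'"
    "\<forall>i. i \<notin> I1 \<longrightarrow> 0 \<le> z $ i" "\<forall>i. i \<notin> I2 \<longrightarrow> 0 \<le> x $ i"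
    "\<forall>i. i \<notin> I1 \<longrightarrow> 0 \<le> z' $ i" "\<forall>i. i \<notin> I2 \<longrightarrow> 0 \<le> x' $ i"
    using assms by (auto simp: tangent_gen_def)
  then show ?thesis unfolding tangent_gen_def mem_Collect_eq
    by (intro exI[of _ "z + z'"] exI[of _ "x + x'"]) (auto simp: matrix_vector_right_distrib)
qed

lemma tangent_gen_scale:
  assumes "a \<in> tangent_gen M I1 I2" "0 \<le> c"
  shows "c *\<^sub>R a \<in> tangent_gen M I1 I2"
proof -
  obtain z x where "a = z - M *v x"
    "\<forall>i. i \<notin> I1 \<longrightarrow> 0 \<le> z $ i" "\<forall>i. i \<notin> I2 \<longrightarrow> 0 \<le> x $ i"
    using assms by (auto simp: tangent_gen_def)
  then show ?thesis unfolding tangent_gen_def mem_Collect_eq using assms(2)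
    by (intro exI[of _ "c *\<^sub>R z"] exI[of _ "c *\<^sub>R x"])
      (auto simp: scaleR_diff_right linear_cmul[OF matrix_vector_mul_linear])
qed

lemma convex_cone_tangent_gen: "convex_cone (tangent_gen M I1 I2)"
proof -
  have "0 \<in> tangent_gen M I1 I2"
    unfolding tangent_gen_def by (auto intro!: exI[of _ 0])
  then show ?thesis by (simp add: convex_cone_iff tangent_gen_add tangent_gen_scale)
qed

text \<open>Moreau decomposition of \<open>u\<close>: \<open>t\<close> is its projection onto the
  tangent cone, and the residual lies in the polar cone, which is \<open>N_set\<close>.\<close>

lemma tangent_gen_projection:
  fixes u :: "real^'n"
  assumes cov: "I1 \<union> I2 \<union> I3 = UNIV"
  obtains t where "t \<in> tangent_gen M I1 I2" "u - t \<in> N_set M I1 I2 I3" "u \<bullet> t = norm t ^ 2"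
proof -
  \<comment> \<open>Finitely many generators make the cone closed, so a closest point exists; the
    negative directions belong to the coordinates without sign constraint.\<close>
  let ?G = "(\<lambda>i. axis i 1) ` UNIV \<union> (\<lambda>i. axis i (- 1)) ` I1 \<union>
    (\<lambda>i. - (M *v axis i 1)) ` UNIV \<union> (\<lambda>i. - (M *v axis i (- 1))) ` I2"
  let ?T = "convex_cone hull ?G"
  have closed: "closed ?T" by (intro closed_convex_cone_hull_finite) auto
  have gen: "z - M *v x \<in> tangent_gen M I1 I2"
    if "\<forall>i. i \<notin> I1 \<longrightarrow> 0 \<le> z $ i" "\<forall>i. i \<notin> I2 \<longrightarrow> 0 \<le> x $ i" for z x
    using that by (auto simp: tangent_gen_def)
  have "?G \<subseteq> tangent_gen M I1 I2"
  proof -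
    have "axis i 1 \<in> tangent_gen M I1 I2" for i
      using gen[of "axis i 1" 0] by (simp add: axis_def)
    moreover have "axis i (- 1) \<in> tangent_gen M I1 I2" if "i \<in> I1" for i
      using gen[of "axis i (- 1)" 0] that by (auto simp: axis_def)
    moreover have "- (M *v axis i 1) \<in> tangent_gen M I1 I2" for i
      using gen[of 0 "axis i 1"] by (simp add: axis_def)
    moreover have "- (M *v axis i (- 1)) \<in> tangent_gen M I1 I2" if "i \<in> I2" for i
      using gen[of 0 "axis i (- 1)"] that by (auto simp: axis_def)
    ultimately show ?thesis by auto
  qed
  then have sub: "?T \<subseteq> tangent_gen M I1 I2"
    by (intro hull_minimal convex_cone_tangent_gen)
  define t where "t = closest_point ?T u"
  define w where "w = u - t"
  have t: "t \<in> ?T" unfolding t_def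
    using closest_point_in_set[OF closed] convex_cone_hull_nonempty by blast
  have dot: "w \<bullet> (z - t) \<le> 0" if "z \<in> ?T" for z
    unfolding t_def w_def using closest_point_dot[OF convex_convex_cone_hull closed that] .
  \<comment> \<open>The variational inequality of the projection is applied to the point
    \<open>t + z\<close> of the cone.\<close>
  have pol: "w \<bullet> z \<le> 0" if "z \<in> ?T" for z
    using dot[OF convex_cone_hull_add[OF t that]] by simp
  have orth: "w \<bullet> t = 0"
    using dot[OF convex_cone_hull_contains_0] pol[OF t] by simp
  have col: "w \<bullet> - (M *v axis i c) = - ((transpose M *v w) $ i * c)" for i c
    by (simp add: dot_lmul_matrix[symmetric] inner_axis)
  have 1: "w $ i \<le> 0" for i
    using pol[OF hull_inc[of "axis i 1"]] by (simp add: inner_axis)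
  have 2: "0 \<le> w $ i" if "i \<in> I1" for i
    using pol[OF hull_inc[of "axis i (- 1)"]] that by (simp add: inner_axis)
  have 3: "0 \<le> (transpose M *v w) $ i" for i
    using pol[OF hull_inc[of "- (M *v axis i 1)"], unfolded col] by simp
  have 4: "(transpose M *v w) $ i \<le> 0" if "i \<in> I2" for i
    using pol[OF hull_inc[of "- (M *v axis i (- 1))"], unfolded col] that by simp
  have "w \<in> N_set M I1 I2 I3"
    unfolding N_set_iff[OF cov] using 1 2 3 4 by (meson order.antisym)
  then show thesis
    using that[of t] t sub orth unfolding w_def by (auto simp: inner_diff_left power2_norm_eq_inner)
qed

section \<open>Regular normals to the graph and the lower bound on the modulus\<close>

text \<open>By \<open>inner_split\<close> the left-hand side is a sum over indices. Its terms vanish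
  on \<open>I1_at\<close> and \<open>I2_at\<close> of \<open>(q, x)\<close>, where \<open>x'\<close>
  obeys the same equations, and are nonpositive on \<open>I3_at\<close> by the signs of
  \<open>u\<close>, of \<open>x'\<close> and of its slack.\<close>

lemma min_coderiv_normal:
  assumes x: "x \<in> LCP M q" and x': "x' \<in> LCP M q'"
    and I: "I1_at M q x \<subseteq> I1_at M q' x'" "I2_at M q x \<subseteq> I2_at M q' x'"
    and u: "u \<in> U_set (I1_at M q x) (I2_at M q x) (I3_at M q x)"
  shows "u \<bullet> (q' - q) + min_coderiv M (I2_at M q x) (I3_at M q x) u \<bullet> (x' - x) \<le> 0"
proof -
  let ?c = "min_coderiv M (I2_at M q x) (I3_at M q x) u"
  let ?v = "transpose M *v u"
  define z where "z = (M *v x' + q') - (M *v x + q)"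
  have q: "q' - q = z - M *v (x' - x)"
    by (simp add: z_def matrix_vector_mult_diff_distrib)
  have "u $ i * z $ i - ?v $ i * (x' - x) $ i + ?c $ i * (x' - x) $ i \<le> 0" for i
  proof -
    consider "i \<in> I1_at M q x" | "i \<in> I2_at M q x" | "i \<in> I3_at M q x"
      using x unfolding LCP_iff I1_at_def I2_at_def I3_at_def
      by (auto simp: order.order_iff_strict)
    then show ?thesis
    proof cases
      case 1
      then have "x $ i = 0" "x' $ i = 0" using I by (auto simp: I1_at_def)
      moreover have "u $ i = 0" using u 1 by (simp add: U_set_def)
      ultimately show ?thesis by simp
    next
      case 2
      then have "z $ i = 0" using I by (auto simp: z_def I2_at_def)
      moreover have "?c $ i = ?v $ i" using 2 by (simp add: min_coderiv_def)
      ultimately show ?thesis by simp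
    next
      case 3
      then have a: "x $ i = 0" "z $ i \<ge> 0" "x' $ i \<ge> 0"
        using x' unfolding LCP_iff by (auto simp: I3_at_def z_def)
      have "u $ i \<le> 0" using u 3 by (simp add: U_set_def)
      then have "u $ i * z $ i \<le> 0" using a by (simp add: mult_nonpos_nonneg)
      moreover have "?c $ i = min 0 (?v $ i)"
        using 3 by (simp add: min_coderiv_def I2_at_def I3_at_def)
      then have "?c $ i \<le> ?v $ i" by simp
      then have "?c $ i * x' $ i \<le> ?v $ i * x' $ i" using a by (simp add: mult_right_mono)
      ultimately show ?thesis using a by simp
    qed
  qed
  then have "(\<Sum>i\<in>UNIV. u $ i * z $ i - ?v $ i * (x' - x) $ i + ?c $ i * (x' - x) $ i) \<le> 0"
    by (simp add: sum_nonpos)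
  then show ?thesis
    unfolding q inner_split by (simp add: inner_vec_def sum.distrib)
qed

lemma mem_plus_scaled_cball:
  fixes A :: "'a::real_normed_vector set"
  assumes "0 \<le> c"
  shows "x \<in> A + (*\<^sub>R) c ` cball 0 1 \<longleftrightarrow> (\<exists>a\<in>A. norm (x - a) \<le> c)"
proof -
  have eq: "(*\<^sub>R) c ` cball (0::'a) 1 = cball 0 c"
  proof (cases "c = 0")
    case True
    then show ?thesis by (auto simp: image_iff intro!: exI[of _ 0])
  next
    case False
    then show ?thesis using assms cball_scale[of c "0::'a" 1] by simp
  qed
  show ?thesis
  proof (intro iffI)
    assume "\<exists>a\<in>A. norm (x - a) \<le> c"
    then obtain a where "a \<in> A" "x - a \<in> cball 0 c" by auto
    then have "a + (x - a) \<in> A + cball 0 c" by (rule set_plus_intro)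
    with eq show "x \<in> A + (*\<^sub>R) c ` cball 0 1" by simp
  next
    assume "x \<in> A + (*\<^sub>R) c ` cball 0 1"
    then obtain a b where "a \<in> A" "b \<in> cball 0 c" "x = a + b"
      unfolding eq by (rule set_plus_elim)
    then show "\<exists>a\<in>A. norm (x - a) \<le> c" by (intro bexI[of _ a]) auto
  qed
qed

lemma eventually_nonneg_ray:
  fixes x d :: "real^'n"
  assumes "\<And>i. 0 \<le> x $ i" "\<And>i. x $ i = 0 \<Longrightarrow> 0 \<le> d $ i"
  shows "\<forall>\<^sub>F e in at_right 0. \<forall>i. 0 \<le> (x + e *\<^sub>R d) $ i"
proof (rule eventually_all_finite)
  fix i
  show "\<forall>\<^sub>F e in at_right 0. 0 \<le> (x + e *\<^sub>R d) $ i"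
  proof (cases "x $ i = 0")
    case True
    then show ?thesis
      using assms(2)[of i] eventually_at_right_less[of "0::real"] by (auto elim!: eventually_mono)
  next
    case False
    have "((\<lambda>e. x $ i + e * d $ i) \<longlongrightarrow> x $ i + 0 * d $ i) (at_right 0)"
      by (intro tendsto_intros)
    moreover have "0 < x $ i + 0 * d $ i" using False assms(1)[of i] by simp
    ultimately have "\<forall>\<^sub>F e in at_right 0. 0 < x $ i + e * d $ i"
      by (rule order_tendstoD)
    then show ?thesis by (auto elim!: eventually_mono)
  qed
qed

text \<open>This is why parameter directions are written \<open>z - M *v d\<close>: solution and
  slack then move independently, by \<open>d\<close> and \<open>z\<close>.\<close>

lemma slack_ray:
  fixes M :: "real^'n^'n"
  shows "M *v (x + e *\<^sub>R d) + (q + e *\<^sub>R (z - M *v d)) = M *v x + q + e *\<^sub>R z"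
  by (simp add: matrix_vector_right_distrib linear_cmul[OF matrix_vector_mul_linear] scaleR_diff_right)

text \<open>The moved point \<open>x + e *\<^sub>R d\<close> is feasible but may violate
  complementarity; the Q0 property then supplies a solution.\<close>

lemma eventually_ray_in_sdom:
  assumes Q0: "Q0_matrix M" and x: "x \<in> LCP M q"
    and t: "t \<in> tangent_gen M (I1_at M q x) (I2_at M q x)"
  shows "\<forall>\<^sub>F e in at_right 0. q + e *\<^sub>R t \<in> sdom (LCP M)"
proof -
  obtain z d where t: "t = z - M *v d" and z: "\<And>i. i \<notin> I1_at M q x \<Longrightarrow> 0 \<le> z $ i"
    and d: "\<And>i. i \<notin> I2_at M q x \<Longrightarrow> 0 \<le> d $ i"
    using t by (auto simp: tangent_gen_def)
  have "\<forall>\<^sub>F e in at_right 0. \<forall>i. 0 \<le> (x + e *\<^sub>R d) $ i"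
    using x d by (intro eventually_nonneg_ray) (auto simp: LCP_iff I2_at_def)
  moreover have "\<forall>\<^sub>F e in at_right 0. \<forall>i. 0 \<le> (M *v x + q + e *\<^sub>R z) $ i"
    using x z by (intro eventually_nonneg_ray) (auto simp: LCP_iff I1_at_def)
  ultimately show ?thesis
  proof eventually_elim
    case (elim e)
    then have "0 \<le> x + e *\<^sub>R d" "0 \<le> M *v (x + e *\<^sub>R d) + (q + e *\<^sub>R t)"
      unfolding t slack_ray by (simp_all add: less_eq_vec_def)
    then show ?case using Q0 unfolding Q0_matrix_def sdom_def by blast
  qed
qed

text \<open>Raising the solution on \<open>I2\<close> and the slack on \<open>I1\<close> by a small
  \<open>e\<close> makes them positive there, while both stay at zero on \<open>I3\<close>.\<close>

lemma index_triple_realized: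
  fixes M :: "real^'n^'n"
  assumes x0: "x0 \<in> LCP M q0" and I: "(I1, I2, I3) \<in> index_triples_at M q0 x0" and r: "r > 0"
  obtains q x where "x \<in> LCP M q" "dist q q0 < r" "dist x x0 < r"
    "I1_at M q x = I1" "I2_at M q x = I2" "I3_at M q x = I3"
proof -
  define b where "b = (\<chi> i. if i \<in> I2 then 1 else (0 :: real))"
  define z where "z = (\<chi> i. if i \<in> I1 then 1 else (0 :: real))"
  define a where "a = z - M *v b"
  define e where "e = r / (1 + norm a + norm b)"
  have pos: "0 < 1 + norm a + norm b" by (simp add: add_pos_nonneg)
  have e: "e > 0" using r pos by (simp add: e_def)
  have "e * norm a < r" "e * norm b < r"
    using r pos by (simp_all add: e_def field_simps add_pos_nonneg)
  then have near: "dist (q0 + e *\<^sub>R a) q0 < r" "dist (x0 + e *\<^sub>R b) x0 < r"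
    using e by (simp_all add: dist_norm)
  have slack: "M *v (x0 + e *\<^sub>R b) + (q0 + e *\<^sub>R a) = M *v x0 + q0 + e *\<^sub>R z"
    unfolding a_def by (rule slack_ray)
  have dis: "I1 \<inter> I2 = {}" "I1 \<inter> I3 = {}" "I2 \<inter> I3 = {}" "I1 \<union> I2 \<union> I3 = UNIV"
    and sub: "I1_at M q0 x0 \<subseteq> I1" "I2_at M q0 x0 \<subseteq> I2" "I3 \<subseteq> I3_at M q0 x0"
    using I by (auto simp: index_triples_at_def index_triples_def)
  have nn: "0 \<le> x0 $ i" "0 \<le> (M *v x0 + q0) $ i" for i
    using x0 by (auto simp: LCP_iff)
  have x_zero: "x0 $ i = 0" if "i \<notin> I2" for i
    using that sub(2) coordinate_eq_0[OF x0] by blast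
  have y_zero: "(M *v x0 + q0) $ i = 0" if "i \<notin> I1" for i
    using that sub(1) slack_eq_0[OF x0] by blast
  have x_pos: "0 < (x0 + e *\<^sub>R b) $ i \<longleftrightarrow> i \<in> I2" "(x0 + e *\<^sub>R b) $ i = 0 \<longleftrightarrow> i \<notin> I2" for i
    using x_zero[of i] nn(1)[of i] e by (auto simp: b_def add_nonneg_eq_0_iff)
  have y_pos: "0 < (M *v x0 + q0 + e *\<^sub>R z) $ i \<longleftrightarrow> i \<in> I1" "(M *v x0 + q0 + e *\<^sub>R z) $ i = 0 \<longleftrightarrow> i \<notin> I1" for i
    using y_zero[of i] nn(2)[of i] e
    unfolding vector_add_component[of "M *v x0 + q0"] by (auto simp del: vector_add_component simp: z_def add_nonneg_eq_0_iff)
  have "x0 + e *\<^sub>R b \<in> LCP M (q0 + e *\<^sub>R a)"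
    unfolding LCP_iff slack using x_pos y_pos dis by (metis disjoint_iff order.order_iff_strict)
  moreover have "I1_at M (q0 + e *\<^sub>R a) (x0 + e *\<^sub>R b) = I1" "I2_at M (q0 + e *\<^sub>R a) (x0 + e *\<^sub>R b) = I2"
    "I3_at M (q0 + e *\<^sub>R a) (x0 + e *\<^sub>R b) = I3"
    unfolding I1_at_def I2_at_def I3_at_def slack x_pos y_pos using dis by auto
  ultimately show thesis using that near by blast
qed

text \<open>With \<open>c\<close> the minimal normal and \<open>q' = q + e *\<^sub>R t\<close>,
  normality and the Lipschitz property give \<open>e * norm t ^ 2 \<le> c \<bullet> (x - x') \<le>
  norm c * \<kappa> * e * norm t\<close>. Hence \<open>norm t \<le> \<kappa> * norm c\<close>, and
  \<open>norm t\<close> bounds the distance to \<open>N_set\<close> because \<open>u - t\<close>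
  lies there.\<close>

lemma lip_constant_lower_bound:
  fixes M :: "real^'n^'n"
  assumes Q0: "Q0_matrix M" and xb: "xb \<in> LCP M qb" and k: "0 \<le> \<kappa>"
    and V: "qb \<in> interior V" and U: "xb \<in> interior U"
    and lip: "\<And>q q'. q \<in> sdom (LCP M) \<inter> V \<Longrightarrow> q' \<in> sdom (LCP M) \<inter> V \<Longrightarrow>
       LCP M q' \<inter> U \<subseteq> LCP M q + (*\<^sub>R) (\<kappa> * norm (q' - q)) ` cball 0 1"
    and I: "(I1, I2, I3) \<in> index_triples_at M qb xb" and u: "u \<in> U_set I1 I2 I3"
  shows "infdist u (N_set M I1 I2 I3) \<le> \<kappa> * norm (min_coderiv M I2 I3 u)"
proof -
  obtain r1 where r1: "r1 > 0" "ball qb r1 \<subseteq> interior V" using V open_interior openE by blast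
  obtain r2 where r2: "r2 > 0" "ball xb r2 \<subseteq> interior U" using U open_interior openE by blast
  obtain q x where x: "x \<in> LCP M q" and near: "dist q qb < min r1 r2" "dist x xb < min r1 r2"
    and at: "I1_at M q x = I1" "I2_at M q x = I2" "I3_at M q x = I3"
    using index_triple_realized[OF xb I, of "min r1 r2"] r1 r2 by (metis min_less_iff_conj)
  have qV: "q \<in> interior V" and xU: "x \<in> U"
    using near r1 r2 interior_subset[of U] by (auto simp: dist_commute subset_eq)
  have cov: "I1 \<union> I2 \<union> I3 = UNIV"
    using I by (auto simp: index_triples_at_def index_triples_def)
  obtain t where t: "t \<in> tangent_gen M I1 I2" "u - t \<in> N_set M I1 I2 I3" "u \<bullet> t = norm t ^ 2"
    using tangent_gen_projection[OF cov] .
  obtain r where r: "r > 0" "\<And>q' x'. x' \<in> LCP M q' \<Longrightarrow> dist q' q < r \<Longrightarrow> dist x' x < r \<Longrightarrow>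
       I1_at M q x \<subseteq> I1_at M q' x' \<and> I2_at M q x \<subseteq> I2_at M q' x'"
    using index_sets_stable[OF x] by metis
  have lim: "((\<lambda>e. q + e *\<^sub>R t) \<longlongrightarrow> q + 0 *\<^sub>R t) (at_right 0)" by (intro tendsto_intros)
  \<comment> \<open>This will keep the solution \<open>x'\<close> at the perturbed parameter within
    the radius \<open>r\<close> on which the index sets can only grow.\<close>
  have "((\<lambda>e. \<kappa> * (e * norm t)) \<longlongrightarrow> \<kappa> * (0 * norm t)) (at_right 0)" by (intro tendsto_intros)
  then have ev1: "\<forall>\<^sub>F e in at_right 0. \<kappa> * (e * norm t) < r"
    using r(1) by (intro order_tendstoD) auto
  have ev2: "\<forall>\<^sub>F e in at_right 0. q + e *\<^sub>R t \<in> interior V"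
    using topological_tendstoD[OF lim, of "interior V"] qV by simp
  have ev3: "\<forall>\<^sub>F e in at_right 0. dist (q + e *\<^sub>R t) q < r"
    using tendstoD[OF lim r(1)] by simp
  have ev4: "\<forall>\<^sub>F e in at_right 0. q + e *\<^sub>R t \<in> sdom (LCP M)"
    using eventually_ray_in_sdom[OF Q0 x, of t] t at by simp
  have "\<forall>\<^sub>F e in at_right 0. 0 < e \<and> \<kappa> * (e * norm t) < r \<and> q + e *\<^sub>R t \<in> interior V \<and>
     dist (q + e *\<^sub>R t) q < r \<and> q + e *\<^sub>R t \<in> sdom (LCP M)"
    using ev1 ev2 ev3 ev4 eventually_at_right_less[of "0::real"] by eventually_elim simp
  then obtain e where e: "0 < e" "\<kappa> * (e * norm t) < r" "q + e *\<^sub>R t \<in> V"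
     "dist (q + e *\<^sub>R t) q < r" "q + e *\<^sub>R t \<in> sdom (LCP M)"
    using eventually_happens'[OF trivial_limit_at_right_real] interior_subset by blast
  define q' where "q' = q + e *\<^sub>R t"
  have qq: "norm (q - q') = e * norm t" using e by (simp add: q'_def)
  have "q \<in> sdom (LCP M) \<inter> V" using x qV interior_subset by (auto simp: sdom_def)
  \<comment> \<open>The known solution \<open>x\<close> at \<open>q\<close> is approximated by one
    at the perturbed parameter \<open>q'\<close>.\<close>
  then have "x \<in> LCP M q' + (*\<^sub>R) (\<kappa> * norm (q - q')) ` cball 0 1"
    using lip[of q' q] e x xU unfolding q'_def by blast
  then obtain x' where x': "x' \<in> LCP M q'" "norm (x - x') \<le> \<kappa> * (e * norm t)"
    unfolding qq using k e by (subst (asm) mem_plus_scaled_cball) auto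
  let ?c = "min_coderiv M I2 I3 u"
  have "dist x' x < r" using x' e by (simp add: dist_norm norm_minus_commute)
  then have "I1_at M q x \<subseteq> I1_at M q' x'" "I2_at M q x \<subseteq> I2_at M q' x'"
    using r(2)[OF x'(1)] e(4) by (auto simp: q'_def)
  from min_coderiv_normal[OF x x'(1) this, of u] u
  have "u \<bullet> (e *\<^sub>R t) + ?c \<bullet> (x' - x) \<le> 0" by (simp add: at q'_def)
  then have "e * norm t ^ 2 \<le> ?c \<bullet> (x - x')" using t by (simp add: inner_diff_right)
  also have "\<dots> \<le> norm ?c * norm (x - x')" by (rule norm_cauchy_schwarz)
  also have "\<dots> \<le> norm ?c * (\<kappa> * (e * norm t))" using x' by (intro mult_left_mono) auto
  finally have "e * (norm t * norm t) \<le> e * ((\<kappa> * norm ?c) * norm t)"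
    by (simp add: power2_eq_square mult_ac)
  then have "norm t * norm t \<le> (\<kappa> * norm ?c) * norm t" using e by simp
  then have "norm t \<le> \<kappa> * norm ?c"
    using k by (cases "t = 0") (auto simp: mult_le_cancel_right)
  moreover have "infdist u (N_set M I1 I2 I3) \<le> dist u (u - t)" by (rule infdist_le[OF t(2)])
  ultimately show ?thesis by (simp add: dist_norm)
qed

section \<open>Stationarity at a minimiser of the smoothed function\<close>

text \<open>The expression under the root is a quadratic polynomial in \<open>t\<close>. The case
  \<open>s = 0\<close> with \<open>c\<close> nonzero covers the unsmoothed norm too.\<close>

lemma smoothed_norm_derivative:
  fixes c d :: "'a::real_inner"
  assumes "0 < norm c ^ 2 + s ^ 2"
  shows "((\<lambda>t. sqrt (norm (c + t *\<^sub>R d) ^ 2 + s ^ 2)) has_real_derivative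
     (c \<bullet> d) / sqrt (norm c ^ 2 + s ^ 2)) (at 0)"
proof -
  have eq: "norm (c + t *\<^sub>R d) ^ 2 + s ^ 2 = norm c ^ 2 + s ^ 2 + 2 * t * (c \<bullet> d) + t ^ 2 * (d \<bullet> d)" for t
    unfolding power2_norm_eq_inner
    by (simp add: inner_add_left inner_add_right inner_commute[of d c] power2_eq_square)
      (simp only: distrib_left mult.assoc)
  let ?p = "\<lambda>t. norm c ^ 2 + s ^ 2 + 2 * t * (c \<bullet> d) + t ^ 2 * (d \<bullet> d)"
  have "(?p has_real_derivative 2 * (c \<bullet> d)) (at 0)"
    by (rule derivative_eq_intros refl | simp)+
  moreover have "(sqrt has_real_derivative inverse (sqrt (?p 0)) / 2) (at (?p 0))"
    using assms by (intro DERIV_real_sqrt) simp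
  ultimately have "((\<lambda>t. sqrt (?p t)) has_real_derivative inverse (sqrt (?p 0)) / 2 * (2 * (c \<bullet> d))) (at 0)"
    by (intro DERIV_chain2[where f = sqrt and g = ?p])
  then show ?thesis unfolding eq by (rule DERIV_cong) (simp add: inverse_eq_divide)
qed

text \<open>Otherwise the derivative at \<open>0\<close> along the direction \<open>(p, d)\<close>
  would be negative, and small positive steps would decrease the function.\<close>

lemma minimizer_direction:
  fixes q q0 p x0 x' d :: "'a::real_inner"
  assumes ne: "q \<noteq> q0" and s: "s > 0"
    and min: "\<forall>\<^sub>F e in at_right 0. \<kappa> * norm (q - q0) + sqrt (norm (x0 - x') ^ 2 + s ^ 2) \<le>
       \<kappa> * norm (q - (q0 + e *\<^sub>R p)) + sqrt (norm (x0 + e *\<^sub>R d - x') ^ 2 + s ^ 2)"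
  shows "((\<kappa> / norm (q - q0)) *\<^sub>R (q - q0)) \<bullet> p \<le> ((x0 - x') /\<^sub>R sqrt (norm (x0 - x') ^ 2 + s ^ 2)) \<bullet> d"
proof (rule ccontr)
  assume neg: "\<not> ?thesis"
  \<comment> \<open>The parameter term is the smoothed norm with smoothing \<open>0\<close>,
    differentiable because \<open>q \<noteq> q0\<close>.\<close>
  let ?f = "\<lambda>e. \<kappa> * sqrt (norm ((q - q0) + e *\<^sub>R (- p)) ^ 2 + 0 ^ 2) +
    sqrt (norm ((x0 - x') + e *\<^sub>R d) ^ 2 + s ^ 2)"
  let ?D = "\<kappa> * (((q - q0) \<bullet> (- p)) / sqrt (norm (q - q0) ^ 2 + 0 ^ 2)) +
    ((x0 - x') \<bullet> d) / sqrt (norm (x0 - x') ^ 2 + s ^ 2)"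
  have "(?f has_real_derivative ?D) (at 0)"
    using ne s by (intro DERIV_add DERIV_cmult smoothed_norm_derivative) (simp_all add: add_nonneg_pos)
  moreover have "?D = ((x0 - x') /\<^sub>R sqrt (norm (x0 - x') ^ 2 + s ^ 2)) \<bullet> d -
      ((\<kappa> / norm (q - q0)) *\<^sub>R (q - q0)) \<bullet> p"
    by (simp add: divide_inverse)
  then have "?D < 0" using neg by simp
  ultimately obtain b where b: "b > 0" "\<And>h. 0 < h \<Longrightarrow> h < b \<Longrightarrow> ?f (0 + h) < ?f 0"
    using DERIV_neg_dec_right[of ?f ?D 0] by blast
  have "\<forall>\<^sub>F e in at_right 0. 0 < e \<and> e < b"
    using b(1) by (intro eventually_at_rightI[of 0 b]) auto
  then have "\<forall>\<^sub>F e in at_right (0::real). False"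
    using min
  proof eventually_elim
    case (elim e)
    have eq: "q - (q0 + e *\<^sub>R p) = (q - q0) + e *\<^sub>R (- p)" "x0 + e *\<^sub>R d - x' = (x0 - x') + e *\<^sub>R d"
      by (simp_all add: algebra_simps)
    from elim(2) have "?f 0 \<le> ?f e" unfolding eq by simp
    then show ?case using elim(1) b(2)[of e] by simp
  qed
  then show False by simp
qed

text \<open>At each index one of coordinate and slack stays zero along the whole ray, which
  preserves complementarity; the signs persist for small steps. These are the directions available
  for stationarity.\<close>

lemma eventually_ray_in_LCP:
  fixes M :: "real^'n^'n"
  assumes x: "x \<in> LCP M q"
    and z: "\<And>i. (M *v x + q) $ i = 0 \<Longrightarrow> 0 \<le> z $ i" and d: "\<And>i. x $ i = 0 \<Longrightarrow> 0 \<le> d $ i"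
    and c: "\<And>i. x $ i = 0 \<and> d $ i = 0 \<or> (M *v x + q) $ i = 0 \<and> z $ i = 0"
  shows "\<forall>\<^sub>F e in at_right 0. x + e *\<^sub>R d \<in> LCP M (q + e *\<^sub>R (z - M *v d))"
proof -
  have "\<forall>\<^sub>F e in at_right 0. \<forall>i. 0 \<le> (x + e *\<^sub>R d) $ i"
    using x d by (intro eventually_nonneg_ray) (auto simp: LCP_iff)
  moreover have "\<forall>\<^sub>F e in at_right 0. \<forall>i. 0 \<le> (M *v x + q + e *\<^sub>R z) $ i"
    using x z by (intro eventually_nonneg_ray) (auto simp: LCP_iff)
  ultimately show ?thesis
  proof eventually_elim
    case (elim e)
    moreover have "(x + e *\<^sub>R d) $ i = 0 \<or> (M *v x + q + e *\<^sub>R z) $ i = 0" for i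
      using c[of i] by auto
    ultimately show ?case unfolding LCP_iff slack_ray by blast
  qed
qed

text \<open>Where \<open>w\<close> is nonzero the slack at \<open>x0\<close> vanishes and can only
  grow; where \<open>transpose M *v w\<close> is nonzero the same holds for the coordinate of
  \<open>x0\<close>. So every term has the right sign, even for \<open>x\<close> far from
  \<open>x0\<close>.\<close>

lemma normal_inequality:
  fixes M :: "real^'n^'n"
  assumes w: "w \<in> N_set M (I1_at M q0 x0) (I2_at M q0 x0) (I3_at M q0 x0)"
    and x0: "x0 \<in> LCP M q0" and x: "x \<in> LCP M q"
  shows "w \<bullet> (q - q0) \<le> 0"
proof -
  define z where "z = (M *v x + q) - (M *v x0 + q0)"
  have q: "q - q0 = z - M *v (x - x0)" by (simp add: z_def matrix_vector_mult_diff_distrib)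
  have cov: "I1_at M q0 x0 \<union> I2_at M q0 x0 \<union> I3_at M q0 x0 = UNIV"
    using index_triples_at_self[OF x0 x0] by (auto simp: index_triples_at_def index_triples_def)
  have "w $ i * z $ i \<le> 0" for i
  proof (cases "i \<in> I1_at M q0 x0")
    case False
    then have "0 \<le> z $ i" using x slack_eq_0[OF x0] by (simp add: LCP_iff z_def)
    then show ?thesis using w unfolding N_set_iff[OF cov] by (simp add: mult_nonpos_nonneg)
  qed (use w in \<open>simp add: N_set_iff[OF cov]\<close>)
  moreover have "0 \<le> (transpose M *v w) $ i * (x - x0) $ i" for i
  proof (cases "i \<in> I2_at M q0 x0")
    case False
    then have "0 \<le> (x - x0) $ i" using x coordinate_eq_0[OF x0] by (simp add: LCP_iff)
    then show ?thesis using w unfolding N_set_iff[OF cov] by simp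
  qed (use w in \<open>simp add: N_set_iff[OF cov]\<close>)
  ultimately have "w $ i * z $ i - (transpose M *v w) $ i * (x - x0) $ i \<le> 0" for i
    by (meson diff_le_0_iff_le order_trans)
  then show ?thesis unfolding q inner_split by (intro sum_nonpos) auto
qed

text \<open>If \<open>q0 \<noteq> q\<close>, stationarity makes the vector \<open>u\<close> defined
  below violate \<open>bound\<close>: its denominator is below \<open>1\<close>, its distance from
  the normal cone at least \<open>\<kappa>\<close>.\<close>

lemma minimizer_parameter:
  fixes M :: "real^'n^'n"
  assumes x0: "x0 \<in> LCP M q0" and q: "q \<in> sdom (LCP M)" and s: "s > 0" and k: "\<kappa> > 0"
    and bound: "\<And>u. u \<in> U_set (I1_at M q0 x0) (I2_at M q0 x0) (I3_at M q0 x0) \<Longrightarrow>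
      infdist u (N_set M (I1_at M q0 x0) (I2_at M q0 x0) (I3_at M q0 x0)) \<le>
      \<kappa> * norm (min_coderiv M (I2_at M q0 x0) (I3_at M q0 x0) u)"
    and min: "\<And>p y. y \<in> LCP M p \<Longrightarrow> \<kappa> * norm (q - q0) + sqrt (norm (x0 - x') ^ 2 + s ^ 2) \<le>
       \<kappa> * norm (q - p) + sqrt (norm (y - x') ^ 2 + s ^ 2)"
  shows "q0 = q"
proof (rule ccontr)
  assume ne: "q0 \<noteq> q"
  define u where "u = (\<kappa> / norm (q - q0)) *\<^sub>R (q - q0)"
  define g where "g = (x0 - x') /\<^sub>R sqrt (norm (x0 - x') ^ 2 + s ^ 2)"
  let ?N = "N_set M (I1_at M q0 x0) (I2_at M q0 x0) (I3_at M q0 x0)"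
  let ?c = "min_coderiv M (I2_at M q0 x0) (I3_at M q0 x0) u"
  have stat: "u \<bullet> z - u \<bullet> (M *v d) \<le> g \<bullet> d"
    if "\<And>i. (M *v x0 + q0) $ i = 0 \<Longrightarrow> 0 \<le> z $ i" "\<And>i. x0 $ i = 0 \<Longrightarrow> 0 \<le> d $ i"
      "\<And>i. x0 $ i = 0 \<and> d $ i = 0 \<or> (M *v x0 + q0) $ i = 0 \<and> z $ i = 0" for z d
  proof -
    have "u \<bullet> (z - M *v d) \<le> g \<bullet> d"
      unfolding u_def g_def
      using ne s eventually_ray_in_LCP[OF x0 that]
      by (intro minimizer_direction) (auto elim!: eventually_mono intro: min)
    then show ?thesis by (simp add: inner_diff_right)
  qed
  have cov: "I1_at M q0 x0 \<union> I2_at M q0 x0 \<union> I3_at M q0 x0 = UNIV"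
    using index_triples_at_self[OF x0 x0] by (auto simp: index_triples_at_def index_triples_def)
  have col: "u \<bullet> (M *v axis i c) = (transpose M *v u) $ i * c" for i c
    by (simp add: dot_lmul_matrix[symmetric] inner_axis)
  have comp: "x0 $ i = 0 \<or> (M *v x0 + q0) $ i = 0" for i
    using x0 by (simp add: LCP_iff)
  \<comment> \<open>Stationarity is tested on single slack and single solution directions, reversed
    where the entry is positive.\<close>
  have up: "u $ i \<le> 0" if "x0 $ i = 0" for i
    using stat[of "axis i 1" 0] that comp unfolding inner_axis by (auto simp: axis_def)
  have un: "0 \<le> u $ i" if "i \<in> I1_at M q0 x0" for i
  proof -
    have "u \<bullet> axis i (- 1) - u \<bullet> (M *v 0) \<le> g \<bullet> 0"
      by (rule stat) (use that comp in \<open>auto simp: axis_def I1_at_def\<close>)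
    then show ?thesis by (simp add: inner_axis)
  qed
  have U: "u \<in> U_set (I1_at M q0 x0) (I2_at M q0 x0) (I3_at M q0 x0)"
    using up un unfolding U_set_def I1_at_def I3_at_def by (auto intro!: order.antisym)
  have gp: "- (transpose M *v u) $ i \<le> g $ i" if "(M *v x0 + q0) $ i = 0" for i
    using stat[of 0 "axis i 1"] that comp unfolding col inner_axis by (auto simp: axis_def)
  have gn: "(transpose M *v u) $ i \<le> - g $ i" if "i \<in> I2_at M q0 x0" for i
  proof -
    have "u \<bullet> 0 - u \<bullet> (M *v axis i (- 1)) \<le> g \<bullet> axis i (- 1)"
      by (rule stat) (use that comp in \<open>auto simp: axis_def I2_at_def\<close>)
    then show ?thesis unfolding col by (simp add: inner_axis)
  qed
  \<comment> \<open>On \<open>I2_at\<close> the two estimates give \<open>?c $ i = - g $ i\<close>;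
    on \<open>I3_at\<close> only a negative entry of \<open>transpose M *v u\<close> counts, and
    \<open>gp\<close> bounds it.\<close>
  have "norm (?c $ i) \<le> norm (g $ i)" for i
  proof -
    consider "i \<in> I2_at M q0 x0" | "i \<in> I3_at M q0 x0" "i \<notin> I2_at M q0 x0"
      | "i \<notin> I2_at M q0 x0" "i \<notin> I3_at M q0 x0" by blast
    then show ?thesis
    proof cases
      case 1
      then have "(M *v x0 + q0) $ i = 0" by (simp add: I2_at_def)
      from gp[OF this] gn[OF 1] 1 show ?thesis by (simp add: min_coderiv_def)
    next
      case 2
      then have "(M *v x0 + q0) $ i = 0" by (simp add: I3_at_def)
      from gp[OF this] 2 show ?thesis by (simp add: min_coderiv_def min_def)
    next
      case 3
      then show ?thesis by (simp add: min_coderiv_def)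
    qed
  qed
  then have "norm ?c \<le> norm g" by (rule norm_le_componentwise_cart)
  also have "norm g < 1"
  proof -
    have "norm (x0 - x') < sqrt (norm (x0 - x') ^ 2 + s ^ 2)"
      using s by (intro real_less_rsqrt) simp
    moreover from this have "0 < sqrt (norm (x0 - x') ^ 2 + s ^ 2)"
      by (rule order.strict_trans1[OF norm_ge_zero])
    ultimately show ?thesis unfolding g_def
      by (simp only: norm_scaleR abs_inverse abs_of_pos) (simp add: field_simps)
  qed
  finally have "\<kappa> * norm ?c < \<kappa>" using k by simp
  moreover have "\<kappa> \<le> infdist u ?N"
  proof -
    \<comment> \<open>Nonemptiness matters, since \<open>infdist\<close> to the empty set is
      \<open>0\<close> by convention.\<close>
    have ne_N: "0 \<in> ?N" by (simp add: N_set_iff[OF cov])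
    have "\<kappa> \<le> dist u w" if w: "w \<in> ?N" for w
    proof -
      \<comment> \<open>The unit vector from \<open>q0\<close> to \<open>q\<close> separates: its
        product with \<open>u\<close> is \<open>\<kappa>\<close>, and with any normal
        \<open>w\<close> at most \<open>0\<close> because \<open>q\<close> lies in the
        domain.\<close>
      define e where "e = (q - q0) /\<^sub>R norm (q - q0)"
      have e: "norm e = 1" "u = \<kappa> *\<^sub>R e"
        using ne by (simp_all add: e_def u_def divide_inverse)
      obtain y where "y \<in> LCP M q" using q by (auto simp: sdom_def)
      then have "w \<bullet> e \<le> 0"
        using normal_inequality[OF w x0] by (simp add: e_def mult_nonneg_nonpos)
      moreover have "u \<bullet> e = \<kappa>" using e by (simp add: power2_norm_eq_inner[symmetric])
      ultimately have "\<kappa> \<le> (u - w) \<bullet> e" by (simp add: inner_diff_left)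
      also have "\<dots> \<le> norm (u - w) * norm e" by (rule norm_cauchy_schwarz)
      finally show ?thesis using e by (simp add: dist_norm)
    qed
    then show ?thesis using ne_N unfolding infdist_def by (auto intro!: cINF_greatest)
  qed
  ultimately show False using bound[OF U] by simp
qed

section \<open>The upper bound on the modulus\<close>

lemma lip_constant_upper_bound:
  fixes M :: "real^'n^'n"
  assumes xb: "xb \<in> LCP M qb" and k: "0 < \<kappa>" "\<kappa> < \<kappa>'"
    and bound: "\<And>I1 I2 I3 u. (I1, I2, I3) \<in> index_triples_at M qb xb \<Longrightarrow> u \<in> U_set I1 I2 I3 \<Longrightarrow>
      infdist u (N_set M I1 I2 I3) \<le> \<kappa> * norm (min_coderiv M I2 I3 u)"
  obtains r where "r > 0" "\<And>q q' x'. q \<in> sdom (LCP M) \<Longrightarrow> x' \<in> LCP M q' \<Longrightarrow>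
    q \<in> ball qb r \<Longrightarrow> q' \<in> ball qb r \<Longrightarrow> x' \<in> ball xb r \<Longrightarrow> \<exists>x\<in>LCP M q. norm (x' - x) \<le> \<kappa>' * norm (q' - q)"
proof -
  obtain R where R: "R > 0" "\<And>q x. x \<in> LCP M q \<Longrightarrow> dist q qb < R \<Longrightarrow> dist x xb < R \<Longrightarrow>
       I1_at M qb xb \<subseteq> I1_at M q x \<and> I2_at M qb xb \<subseteq> I2_at M q x"
    using index_sets_stable[OF xb] by metis
  \<comment> \<open>With \<open>r * C = R\<close> and \<open>D < 2 * r\<close>, every point of the
    compact box used below stays within \<open>R\<close> of \<open>(qb, xb)\<close>.\<close>
  define C where "C = 1 + 2 * \<kappa>' + 2 * (\<kappa>' / \<kappa>)"
  define r where "r = R / C"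
  have C: "C > 0" using k by (simp add: C_def add_pos_pos)
  have r: "r > 0" using R C by (simp add: r_def)
  have rC: "r * C = R" using C by (simp add: r_def)
  show thesis
  proof (rule that[OF r])
    fix q q' x'
    assume q: "q \<in> sdom (LCP M)" and x': "x' \<in> LCP M q'"
      and near: "q \<in> ball qb r" "q' \<in> ball qb r" "x' \<in> ball xb r"
    show "\<exists>x\<in>LCP M q. norm (x' - x) \<le> \<kappa>' * norm (q' - q)"
    proof (cases "q = q'")
      case True
      then show ?thesis using x' by (intro bexI[of _ x']) auto
    next
      case ne: False
      define D where "D = norm (q - q')"
      \<comment> \<open>The gap between \<open>\<kappa>\<close> and \<open>\<kappa>'\<close> pays
        for the smoothing: the starting point \<open>(q', x')\<close> has value exactly
        \<open>\<kappa>' * D\<close>.\<close>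
      define s where "s = (\<kappa>' - \<kappa>) * D"
      have D: "D > 0" "D < 2 * r"
        using ne near dist_triangle_less_add[of q qb r q' r]
        by (auto simp: D_def dist_norm[symmetric] dist_commute)
      have s: "s > 0" using D k by (simp add: s_def)
      have ks: "\<kappa> * D + s = \<kappa>' * D" by (simp add: s_def algebra_simps)
      define f where "f = (\<lambda>p::(real^'n) \<times> (real^'n). \<kappa> * norm (q - fst p) + sqrt (norm (snd p - x') ^ 2 + s ^ 2))"
      \<comment> \<open>Outside this box the function is at least \<open>\<kappa>' * D\<close>, its
        value at \<open>(q', x')\<close>, so a minimiser on the compact part is global. The second
        radius is also the final estimate for \<open>x0\<close>.\<close>
      let ?K = "gph (LCP M) \<inter> (cball q (\<kappa>' / \<kappa> * D) \<times> cball x' (\<kappa>' * D))"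
      have "compact ?K"
        by (intro closed_Int_compact closed_gph_LCP compact_Times compact_cball)
      moreover have mem: "(q', x') \<in> ?K"
        using x' k D by (auto simp: gph_def dist_norm D_def[symmetric] divide_simps)
      moreover have "continuous_on ?K f" unfolding f_def by (intro continuous_intros)
      ultimately obtain p where p: "p \<in> ?K" "\<And>y. y \<in> ?K \<Longrightarrow> f p \<le> f y"
        using continuous_attains_inf[of ?K f] by blast
      obtain q0 x0 where [simp]: "p = (q0, x0)" by (cases p)
      have x0: "x0 \<in> LCP M q0" and q0: "dist q q0 \<le> \<kappa>' / \<kappa> * D" and x0': "dist x' x0 \<le> \<kappa>' * D"
        using p(1) by (auto simp: gph_def)
      have f_start: "f (q', x') = \<kappa>' * D" using s by (simp add: f_def D_def[symmetric] ks)
      have min: "f (q0, x0) \<le> f (a, y)" if ay: "y \<in> LCP M a" for a y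
      proof (cases "(a, y) \<in> ?K")
        case True
        then show ?thesis using p(2) by simp
      next
        case False
        then consider "\<kappa>' / \<kappa> * D < norm (q - a)" | "\<kappa>' * D < norm (y - x')"
          using ay by (auto simp: gph_def dist_norm norm_minus_commute not_le)
        then have "\<kappa>' * D \<le> f (a, y)"
        proof cases
          case 1
          then have "\<kappa>' * D \<le> \<kappa> * norm (q - a)" using k by (simp add: field_simps)
          then show ?thesis by (simp add: f_def add_increasing2)
        next
          case 2
          have "norm (y - x') \<le> sqrt (norm (y - x') ^ 2 + s ^ 2)" by (rule real_le_rsqrt) simp
          moreover have "0 \<le> \<kappa> * norm (q - a)" using k by simp
          ultimately show ?thesis using 2 unfolding f_def fst_conv snd_conv by linarith
        qed
        then show ?thesis using p(2)[OF mem] f_start by simp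
      qed
      have "\<kappa>' / \<kappa> * D \<le> \<kappa>' / \<kappa> * (2 * r)" "\<kappa>' * D \<le> \<kappa>' * (2 * r)"
        using D k by (intro mult_left_mono; simp)+
      moreover have "R = r + \<kappa>' * (2 * r) + \<kappa>' / \<kappa> * (2 * r)"
        unfolding rC[symmetric] C_def by (simp add: algebra_simps)
      moreover have "0 \<le> \<kappa>' * (2 * r)" "0 \<le> \<kappa>' / \<kappa> * (2 * r)" using r k by simp_all
      ultimately have "dist q0 qb < R" "dist x0 xb < R"
        using dist_triangle[of q0 qb q] dist_triangle[of x0 xb x'] q0 x0' near
        by (auto simp: dist_commute)
      then have I: "(I1_at M q0 x0, I2_at M q0 x0, I3_at M q0 x0) \<in> index_triples_at M qb xb"
        using R(2)[OF x0] index_triples_at_self[OF x0 xb] by blast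
      have "q0 = q"
      proof (rule minimizer_parameter[OF x0 q s k(1) bound[OF I], where x' = x'])
        fix a y assume "y \<in> LCP M a"
        from min[OF this] show "\<kappa> * norm (q - q0) + sqrt (norm (x0 - x') ^ 2 + s ^ 2) \<le>
            \<kappa> * norm (q - a) + sqrt (norm (y - x') ^ 2 + s ^ 2)"
          by (simp add: f_def)
      qed
      then show ?thesis
        using x0 x0' by (auto simp: dist_norm D_def norm_minus_commute)
    qed
  qed
qed

section \<open>Equality of the modulus and the supremum\<close>

theorem corollary5p9:
  fixes M :: "real^'n^'n" and qb xb :: "real^'n"
  assumes "Q0_matrix M"
    and "(qb, xb) \<in> gph (LCP M)"
    and "\<forall>u. (u, - (transpose M *v u)) \<in> W_set (I1_at M qb xb) (I2_at M qb xb) (I3_at M qb xb) \<longrightarrow>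
             (u, - (transpose M *v u)) \<in> W'_set (I1_at M qb xb) (I2_at M qb xb) (I3_at M qb xb)"
  shows "lip_rel (sdom (LCP M)) (LCP M) qb xb =
    (SUP (I1, I2, I3) \<in> index_triples_at M qb xb. SUP u \<in> U_set I1 I2 I3. quot M I1 I2 I3 u)"
    (is "?L = ?R")
proof (rule order.antisym)
  have xb: "xb \<in> LCP M qb" using assms(2) by (simp add: gph_def)
  have quot_le: "quot M I1 I2 I3 u \<le> ereal \<kappa> \<longleftrightarrow>
      infdist u (N_set M I1 I2 I3) \<le> \<kappa> * norm (min_coderiv M I2 I3 u)"
    if "(I1, I2, I3) \<in> index_triples_at M qb xb" "0 \<le> \<kappa>" for I1 I2 I3 u \<kappa>
  proof -
    have "I2 \<inter> I3 = {}" using that by (auto simp: index_triples_at_def index_triples_def)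
    from quot_eq[OF this] show ?thesis
      using that by (simp only: ereal_divide_le_iff infdist_nonneg norm_ge_zero)
  qed
  have le_R: "quot M I1 I2 I3 u \<le> ?R"
    if "(I1, I2, I3) \<in> index_triples_at M qb xb" "u \<in> U_set I1 I2 I3" for I1 I2 I3 u
    using that by (intro SUP_upper2[of "(I1, I2, I3)"]) (auto intro: SUP_upper)
  show "?R \<le> ?L"
    unfolding lip_rel_def
  proof (rule Inf_greatest)
    fix k assume "k \<in> {ereal \<kappa> | \<kappa>. 0 \<le> \<kappa> \<and> (\<exists>V U. qb \<in> interior V \<and> xb \<in> interior U \<and>
        (\<forall>q \<in> sdom (LCP M) \<inter> V. \<forall>q' \<in> sdom (LCP M) \<inter> V.
           LCP M q' \<inter> U \<subseteq> LCP M q + (*\<^sub>R) (\<kappa> * norm (q' - q)) ` cball 0 1))}"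
    then obtain \<kappa> V U where k: "k = ereal \<kappa>" "0 \<le> \<kappa>" "qb \<in> interior V" "xb \<in> interior U"
      and lip: "\<And>q q'. q \<in> sdom (LCP M) \<inter> V \<Longrightarrow> q' \<in> sdom (LCP M) \<inter> V \<Longrightarrow>
           LCP M q' \<inter> U \<subseteq> LCP M q + (*\<^sub>R) (\<kappa> * norm (q' - q)) ` cball 0 1"
      by blast
    have "quot M I1 I2 I3 u \<le> k"
      if "(I1, I2, I3) \<in> index_triples_at M qb xb" "u \<in> U_set I1 I2 I3" for I1 I2 I3 u
      unfolding k(1) quot_le[OF that(1) k(2)]
      using lip_constant_lower_bound[OF assms(1) xb k(2-4) lip that] .
    then show "?R \<le> k" by (auto intro!: SUP_least)
  qed
  show "?L \<le> ?R"
  proof (rule dense_ge)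
    fix k assume k: "?R < k"
    have "(I1_at M qb xb, I2_at M qb xb, I3_at M qb xb) \<in> index_triples_at M qb xb"
      using index_triples_at_self[OF xb xb] by simp
    \<comment> \<open>The quotient at \<open>u = 0\<close> is nonnegative. This excludes
      \<open>- \<infinity>\<close> and makes the constant \<open>\<kappa>\<close> chosen below
      positive.\<close>
    from le_R[OF this, of 0] have "0 \<le> ?R"
      unfolding quot_def divide_ereal_def
      by (rule order_trans[rotated])
        (auto simp: U_set_def infdist_nonneg intro!: ereal_0_le_mult inverse_ereal_ge0I)
    show "?L \<le> k"
    proof (cases k)
      case (real \<kappa>')
      \<comment> \<open>Two constants above the supremum are needed: \<open>\<kappa>\<close> bounds
        the quotients, and the larger \<open>\<kappa>'\<close> leaves room for the
        smoothing.\<close>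
      obtain l where l: "?R < l" "l < k" using dense[OF k] by blast
      then obtain \<kappa> where [simp]: "l = ereal \<kappa>" using \<open>0 \<le> ?R\<close> real by (cases l) auto
      have pos: "0 < \<kappa>" using order.strict_trans1[OF \<open>0 \<le> ?R\<close> l(1)] by simp
      have lt: "\<kappa> < \<kappa>'" using l(2) real by simp
      have "infdist u (N_set M I1 I2 I3) \<le> \<kappa> * norm (min_coderiv M I2 I3 u)"
        if "(I1, I2, I3) \<in> index_triples_at M qb xb" "u \<in> U_set I1 I2 I3" for I1 I2 I3 u
        using quot_le[OF that(1), of \<kappa> u] pos order.trans[OF le_R[OF that] less_imp_le[OF l(1)]] by simp
      from lip_constant_upper_bound[OF xb pos lt this]
      obtain r where r: "r > 0" "\<And>q q' x'. q \<in> sdom (LCP M) \<Longrightarrow> x' \<in> LCP M q' \<Longrightarrow>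
          q \<in> ball qb r \<Longrightarrow> q' \<in> ball qb r \<Longrightarrow> x' \<in> ball xb r \<Longrightarrow>
          \<exists>x\<in>LCP M q. norm (x' - x) \<le> \<kappa>' * norm (q' - q)" by blast
      have "LCP M q' \<inter> ball xb r \<subseteq> LCP M q + (*\<^sub>R) (\<kappa>' * norm (q' - q)) ` cball 0 1"
        if "q \<in> sdom (LCP M) \<inter> ball qb r" "q' \<in> sdom (LCP M) \<inter> ball qb r" for q q'
      proof
        fix x' assume "x' \<in> LCP M q' \<inter> ball xb r"
        then show "x' \<in> LCP M q + (*\<^sub>R) (\<kappa>' * norm (q' - q)) ` cball 0 1"
          using r(2)[of q x' q'] that pos lt by (simp add: mem_plus_scaled_cball)
      qed
      moreover have "qb \<in> interior (ball qb r)" "xb \<in> interior (ball xb r)" "0 \<le> \<kappa>'"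
        using r(1) pos lt by simp_all
      ultimately show ?thesis
        unfolding lip_rel_def real
        by (intro Inf_lower CollectI exI[of _ \<kappa>'] conjI refl exI[of _ "ball qb r"] exI[of _ "ball xb r"] ballI) auto
    qed (use \<open>0 \<le> ?R\<close> k in auto)
  qed
qed

end
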